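(* Let $\mathcal H_k$ be a complex Hilbert space of finite dimension $d_k\ge2$, let $\hat V^0_k,\hat V^1_k$ be self-adjoint operators on $\mathcal H_k$, let $\hat\rho^k(0)$ be a density operator on $\mathcal H_k$, and for $i\in\{0,1\}$ and $t\in\mathbb R$ let $$\hat\rho^k_{ii}(t)=e^{-i\hat V^i_kt}\,\hat\rho^k(0)\,e^{i\hat V^i_kt}$$ be the state of the $k$-th environment conditional on the qubit pointer state $|i\rangle$. If at some time $t$ the strict orthogonality condition $$\hat\rho^k_{00}(t)\,\hat\rho^k_{11}(t)=0$$ holds, then the initial purity $P^k(0)=\mathrm{Tr}\big[\hat\rho^k(0)^2\big]$ satisfies $$P^k(0)\ge\frac{2}{d_k}\quad\text{if } d_k \text{ is even},\qquad P^k(0)\ge\frac{2}{d_k-1}\quad\text{if } d_k\text{ is odd}.$$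
   Context: Units with $\hbar=1$. In the exponents $e^{\mp i\hat V^i_kt}$ the first $i$ is the imaginary unit, while the superscript $i\in\{0,1\}$ labels the qubit pointer state. *)

theory Defs
  imports "HOL-Analysis.Analysis"
begin

text \<open>
  Complex Hilbert spaces. The inner product is antilinear in its first argument (the physics
  convention), and the norm and the real vector space structure are those it induces;
  completeness comes from \<^class>\<open>banach\<close>.
\<close>

class complex_hilbert = banach +
  fixes scaleC :: "complex \<Rightarrow> 'a \<Rightarrow> 'a"  (infixr "*\<^sub>C" 75)
    and cinner :: "'a \<Rightarrow> 'a \<Rightarrow> complex"
  assumes scaleC_add_right: "a *\<^sub>C (x + y) = a *\<^sub>C x + a *\<^sub>C y"
    and scaleC_add_left: "(a + b) *\<^sub>C x = a *\<^sub>C x + b *\<^sub>C x"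
    and scaleC_scaleC: "a *\<^sub>C (b *\<^sub>C x) = (a * b) *\<^sub>C x"
    and scaleR_scaleC: "r *\<^sub>R x = complex_of_real r *\<^sub>C x"
    and cinner_commute: "cinner x y = cnj (cinner y x)"
    and cinner_add_right: "cinner x (y + z) = cinner x y + cinner x z"
    and cinner_scaleC_right: "cinner x (a *\<^sub>C y) = a * cinner x y"
    and cinner_norm: "cinner x x = complex_of_real ((norm x)\<^sup>2)"

lemma scaleC_one: "1 *\<^sub>C (x :: 'a::complex_hilbert) = x"
  using scaleR_scaleC[of 1 x] by simp

global_interpretation complex_vector:
  vector_space "scaleC :: complex \<Rightarrow> 'a \<Rightarrow> 'a::complex_hilbert"
  by unfold_locales (simp_all add: scaleC_add_right scaleC_add_left scaleC_scaleC scaleC_one)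

text \<open>The spaces \<open>\<complex>\<^sup>n\<close> with their usual inner product are instances.\<close>

instantiation complex :: complex_hilbert
begin
definition scaleC_complex :: "complex \<Rightarrow> complex \<Rightarrow> complex"
  where "scaleC_complex a x = a * x"
definition cinner_complex :: "complex \<Rightarrow> complex \<Rightarrow> complex"
  where "cinner_complex x y = cnj x * y"
instance
proof
  fix x :: complex
  show "cinner x x = complex_of_real ((norm x)\<^sup>2)"
    unfolding cinner_complex_def complex_norm_square by (rule mult.commute)
qed (simp_all only: scaleC_complex_def cinner_complex_def distrib_left distrib_right
      mult.assoc mult.left_commute mult.commute scaleR_conv_of_real complex_cnj_mult complex_cnj_cnj)
end

instantiation vec :: (complex_hilbert, finite) complex_hilbert
begin
definition scaleC_vec :: "complex \<Rightarrow> 'a ^ 'b \<Rightarrow> 'a ^ 'b"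
  where "scaleC_vec a x = (\<chi> i. a *\<^sub>C (x $ i))"
definition cinner_vec :: "'a ^ 'b \<Rightarrow> 'a ^ 'b \<Rightarrow> complex"
  where "cinner_vec x y = (\<Sum>i\<in>UNIV. cinner (x $ i) (y $ i))"
instance
proof
  fix x y z :: "'a ^ 'b" and a :: complex
  show "cinner x y = cnj (cinner y x)"
    unfolding cinner_vec_def cnj_sum by (rule sum.cong[OF refl]) (rule cinner_commute)
  show "cinner x x = complex_of_real ((norm x)\<^sup>2)"
    by (simp add: cinner_vec_def cinner_norm norm_vec_def L2_set_def sum_nonneg)
qed (simp_all add: scaleC_vec_def cinner_vec_def vec_eq_iff scaleC_add_right scaleC_add_left
      scaleC_scaleC scaleR_scaleC cinner_add_right cinner_scaleC_right sum.distrib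
      sum_distrib_left)
end

definition self_adjoint :: "('h::complex_hilbert \<Rightarrow> 'h) \<Rightarrow> bool" where
  "self_adjoint A \<longleftrightarrow>
     Vector_Spaces.linear scaleC scaleC A \<and> (\<forall>x y. cinner x (A y) = cinner (A x) y)"

definition orthonormal_basis :: "'h::complex_hilbert set \<Rightarrow> bool" where
  "orthonormal_basis B \<longleftrightarrow>
     finite B \<and> (\<forall>b\<in>B. \<forall>c\<in>B. cinner b c = (if b = c then 1 else 0)) \<and>
     complex_vector.span B = UNIV"

text \<open>On a finite-dimensional space the value does not depend on the chosen basis.\<close>

definition op_trace :: "('h::complex_hilbert \<Rightarrow> 'h) \<Rightarrow> complex" where
  "op_trace A = (\<Sum>b\<in>(SOME B. orthonormal_basis B). cinner b (A b))"

definition density_operator :: "('h::complex_hilbert \<Rightarrow> 'h) \<Rightarrow> bool" where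
  "density_operator \<rho> \<longleftrightarrow>
     self_adjoint \<rho> \<and> (\<forall>x. cinner x (\<rho> x) \<in> \<real>\<^sub>\<ge>\<^sub>0) \<and> op_trace \<rho> = 1"

definition op_exp :: "('h::complex_hilbert \<Rightarrow> 'h) \<Rightarrow> 'h \<Rightarrow> 'h" where
  "op_exp A x = (\<Sum>n. (A ^^ n) x /\<^sub>R fact n)"

definition conditional_state ::
    "('h::complex_hilbert \<Rightarrow> 'h) \<Rightarrow> ('h \<Rightarrow> 'h) \<Rightarrow> real \<Rightarrow> 'h \<Rightarrow> 'h" where
  "conditional_state V \<rho> t =
     op_exp (\<lambda>x. (- \<i> * complex_of_real t) *\<^sub>C V x) \<circ> \<rho> \<circ>
     op_exp (\<lambda>x. (\<i> * complex_of_real t) *\<^sub>C V x)"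

text \<open>The trace of the square of a self-adjoint operator is real, so \<^const>\<open>Re\<close> loses nothing.\<close>

definition purity :: "('h::complex_hilbert \<Rightarrow> 'h) \<Rightarrow> real" where
  "purity \<rho> = Re (op_trace (\<rho> \<circ> \<rho>))"

end

theory Submission
  imports Defs
begin

text \<open>
  Orthogonality says \<open>\<rho> W \<rho> = 0\<close> for the invertible operator
  \<open>W = exp (i V0 t) exp (- i V1 t)\<close>, so \<open>W\<close> embeds the range of \<open>\<rho>\<close> into its kernel, which is the
  orthogonal complement of the range. Hence the rank \<open>r\<close> of \<open>\<rho>\<close> satisfies \<open>2 r \<le> d\<close>.
  Evaluating both traces in an orthonormal basis \<open>E\<close> of the range of \<open>\<rho>\<close>, the Cauchy-Schwarz inequality gives
  \<open>1 = (\<Sum>e\<in>E. \<langle>e, \<rho> e\<rangle>)\<^sup>2 \<le> r (\<Sum>e\<in>E. \<parallel>\<rho> e\<parallel>\<^sup>2) = r Tr \<rho>\<^sup>2\<close>.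
\<close>

section \<open>Inner products and orthonormal sets\<close>

lemma cinner_add_left: "cinner (x + y) (z :: 'a::complex_hilbert) = cinner x z + cinner y z"
  by (metis cinner_add_right cinner_commute complex_cnj_add)

lemma cinner_scaleC_left: "cinner (a *\<^sub>C x) (y :: 'a::complex_hilbert) = cnj a * cinner x y"
  by (metis cinner_scaleC_right cinner_commute complex_cnj_mult)

lemma cinner_zero_right [simp]: "cinner x (0 :: 'a::complex_hilbert) = 0"
  using cinner_add_right[of x 0 0] by simp

lemma cinner_zero_left [simp]: "cinner (0 :: 'a::complex_hilbert) x = 0"
  using cinner_add_left[of 0 0 x] by simp

lemma cinner_diff_right: "cinner x (y - z :: 'a::complex_hilbert) = cinner x y - cinner x z"
  using cinner_add_right[of x "y - z" z] by simp

lemma cinner_sum_right: "cinner (x :: 'a::complex_hilbert) (\<Sum>i\<in>I. f i) = (\<Sum>i\<in>I. cinner x (f i))"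
  by (induction I rule: infinite_finite_induct) (simp_all add: cinner_add_right)

lemma norm_scaleC: "norm (a *\<^sub>C (x :: 'a::complex_hilbert)) = norm a * norm x"
proof -
  have "complex_of_real ((norm (a *\<^sub>C x))\<^sup>2) = (a * cnj a) * complex_of_real ((norm x)\<^sup>2)"
    unfolding cinner_norm[symmetric] by (simp add: cinner_scaleC_left cinner_scaleC_right)
  also have "\<dots> = complex_of_real ((norm a * norm x)\<^sup>2)"
    by (simp only: complex_norm_square[symmetric] power_mult_distrib of_real_mult of_real_power)
  finally have "(norm (a *\<^sub>C x))\<^sup>2 = (norm a * norm x)\<^sup>2"
    by (simp only: of_real_eq_iff)
  then show ?thesis by simp
qed

text \<open>Cauchy-Schwarz against a unit vector: subtracting from \<open>x\<close> its component
  along \<open>e\<close> leaves a vector orthogonal to \<open>e\<close>, and Pythagoras gives the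
  bound.\<close>

lemma norm_cinner_unit_le:
  fixes e x :: "'a::complex_hilbert"
  assumes "norm e = 1"
  shows "norm (cinner e x) \<le> norm x"
proof -
  define c where "c = cinner e x"
  define y where "y = x - c *\<^sub>C e"
  have ee: "cinner e e = 1" using assms by (simp add: cinner_norm)
  have ey: "cinner e y = 0" by (simp add: y_def c_def cinner_diff_right cinner_scaleC_right ee)
  then have ye: "cinner y e = 0" by (metis cinner_commute complex_cnj_zero)
  have x: "x = y + c *\<^sub>C e" by (simp add: y_def)
  have "complex_of_real ((norm x)\<^sup>2) = complex_of_real ((norm y)\<^sup>2) + c * cnj c"
    unfolding cinner_norm[symmetric] by (subst (1 2) x)
      (simp add: cinner_add_left cinner_add_right cinner_scaleC_left cinner_scaleC_right ee ey ye)
  also have "\<dots> = complex_of_real ((norm y)\<^sup>2 + (norm c)\<^sup>2)"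
    by (simp only: complex_norm_square[symmetric] of_real_add)
  finally have "(norm x)\<^sup>2 = (norm y)\<^sup>2 + (norm c)\<^sup>2" by (simp only: of_real_eq_iff)
  then have "(norm c)\<^sup>2 \<le> (norm x)\<^sup>2" by simp
  then show ?thesis unfolding c_def by (rule power2_le_imp_le) simp
qed

text \<open>Separated from \<open>orthonormal_basis\<close> so that it also applies to bases of
  proper subspaces, such as the range of a density operator.\<close>

definition orthonormal_set :: "'h::complex_hilbert set \<Rightarrow> bool" where
  "orthonormal_set E \<longleftrightarrow> (\<forall>b\<in>E. \<forall>c\<in>E. cinner b c = (if b = c then 1 else 0))"

lemma orthonormal_set_norm: "orthonormal_set E \<Longrightarrow> e \<in> E \<Longrightarrow> norm e = 1"
  using cinner_norm[of e] by (simp add: orthonormal_set_def abs_square_eq_1 flip: of_real_power)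

lemma cinner_span_eq_0:
  fixes S :: "'h::complex_hilbert set"
  assumes "x \<in> complex_vector.span S" and "\<And>s. s \<in> S \<Longrightarrow> cinner y s = 0"
  shows "cinner y x = 0"
  using assms(1)
  by (induction rule: complex_vector.span_induct_alt)
    (simp_all add: cinner_add_right cinner_scaleC_right assms(2))

text \<open>A member lying in the span of the others would be orthogonal to itself. This turns
  orthonormal sets into dimension counts.\<close>

lemma orthonormal_set_independent:
  fixes E :: "'h::complex_hilbert set"
  assumes "orthonormal_set E"
  shows "complex_vector.independent E"
proof
  assume "complex_vector.dependent E"
  then obtain e where e: "e \<in> E" "e \<in> complex_vector.span (E - {e})"
    unfolding complex_vector.dependent_def by blast
  have "cinner e e = 0"
    by (rule cinner_span_eq_0[OF e(2)]) (use assms e(1) in \<open>auto simp: orthonormal_set_def\<close>)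
  then show False using assms e(1) by (simp add: orthonormal_set_def)
qed

lemma orthonormal_expansion:
  fixes E :: "'h::complex_hilbert set"
  assumes "finite E" "orthonormal_set E" "x \<in> complex_vector.span E"
  shows "x = (\<Sum>e\<in>E. cinner e x *\<^sub>C e)"
proof -
  obtain u where x: "x = (\<Sum>v\<in>E. u v *\<^sub>C v)"
    using assms(3) unfolding complex_vector.span_finite[OF assms(1)] by blast
  have "cinner e x = u e" if "e \<in> E" for e
  proof -
    have "cinner e x = (\<Sum>v\<in>E. if v = e then u v else 0)"
      unfolding x cinner_sum_right using assms(2) that
      by (intro sum.cong) (auto simp: cinner_scaleC_right orthonormal_set_def)
    then show ?thesis using assms(1) that by simp
  qed
  then show ?thesis by (subst x) (intro sum.cong, simp_all)
qed

text \<open>Only \<open>y\<close> is confined to the span, while \<open>x\<close> is arbitrary; the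
  trace computation relies on this asymmetry.\<close>

lemma cinner_parseval:
  fixes E :: "'h::complex_hilbert set"
  assumes "finite E" "orthonormal_set E" "y \<in> complex_vector.span E"
  shows "cinner x y = (\<Sum>e\<in>E. cinner e y * cinner x e)"
  by (subst orthonormal_expansion[OF assms]) (simp add: cinner_sum_right cinner_scaleC_right)

text \<open>Each new vector contributes its normalised residual after projection to the previous
  span, or nothing if that residual vanishes.\<close>

lemma gram_schmidt:
  fixes S :: "'h::complex_hilbert set"
  assumes "finite S"
  shows "\<exists>E. finite E \<and> orthonormal_set E \<and> complex_vector.span E = complex_vector.span S"
  using assms
proof (induction S rule: finite_induct)
  case empty
  show ?case by (rule exI[of _ "{}"]) (simp add: orthonormal_set_def)
next
  case (insert x S)
  then obtain E where E: "finite E" "orthonormal_set E"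
    "complex_vector.span E = complex_vector.span S" by blast
  define p where "p = (\<Sum>e\<in>E. cinner e x *\<^sub>C e)"
  define u where "u = x - p"
  have p: "p \<in> complex_vector.span E"
    unfolding p_def
    by (intro complex_vector.span_sum complex_vector.span_scale complex_vector.span_base)
  have eu: "cinner e u = 0" if "e \<in> E" for e
  proof -
    have "cinner e p = (\<Sum>f\<in>E. if f = e then cinner f x else 0)"
      unfolding p_def cinner_sum_right using E(2) that
      by (intro sum.cong) (auto simp: cinner_scaleC_right orthonormal_set_def)
    then show ?thesis using E(1) that by (simp add: u_def cinner_diff_right)
  qed
  have span_x: "complex_vector.span (insert x S) = complex_vector.span (insert x E)"
    by (simp add: complex_vector.span_insert E(3))
  show ?case
  proof (cases "u = 0")
    case True
    then have "x \<in> complex_vector.span E" using p by (simp add: u_def)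
    then show ?thesis using E(1,2) span_x complex_vector.span_redundant by blast
  next
    case False
    define n where "n = complex_of_real (norm u)"
    have n0: "n \<noteq> 0" using False by (simp add: n_def)
    define f where "f = inverse n *\<^sub>C u"
    have "norm f = 1" using False by (simp add: f_def n_def norm_scaleC norm_inverse)
    then have ff: "cinner f f = 1" by (simp add: cinner_norm)
    have ef: "cinner e f = 0" if "e \<in> E" for e
      using eu[OF that] by (simp add: f_def cinner_scaleC_right)
    then have fe: "cinner f e = 0" if "e \<in> E" for e
      by (metis that cinner_commute complex_cnj_zero)
    have orth: "orthonormal_set (insert f E)"
      using E(2) ff ef fe by (auto simp: orthonormal_set_def)
    \<comment> \<open>Each of \<open>x\<close> and \<open>f\<close> is a combination of the other
      and \<open>p\<close>, so exchanging them leaves the span unchanged.\<close>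
    have x: "x = n *\<^sub>C f + p"
      using n0 by (simp add: f_def scaleC_scaleC scaleC_one) (simp add: u_def)
    have f: "f = inverse n *\<^sub>C (x - p)" by (simp add: f_def u_def)
    have pin: "p \<in> complex_vector.span (insert y E)" for y
      using p complex_vector.span_mono[of E "insert y E"] by blast
    have "x \<in> complex_vector.span (insert f E)"
      unfolding x by (intro complex_vector.span_add complex_vector.span_scale pin
          complex_vector.span_base) simp
    moreover have "f \<in> complex_vector.span (insert x E)"
      unfolding f by (intro complex_vector.span_diff complex_vector.span_scale pin
          complex_vector.span_base) simp
    ultimately have "complex_vector.span (insert f E) = complex_vector.span (insert x E)"
      unfolding complex_vector.span_eq
      using complex_vector.span_superset[of "insert f E"] complex_vector.span_superset[of "insert x E"]
      by blast
    then show ?thesis using E(1) orth span_x by (metis finite_insert)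
  qed
qed

section \<open>Consequences of finite dimension: orthonormal bases and boundedness\<close>

lemma orthonormal_basis_iff:
  "orthonormal_basis B \<longleftrightarrow> finite B \<and> orthonormal_set B \<and> complex_vector.span B = UNIV"
  by (simp add: orthonormal_basis_def orthonormal_set_def)

lemma orthonormal_basis_exists:
  assumes "\<exists>B :: 'h::complex_hilbert set. finite B \<and> complex_vector.span B = UNIV"
  shows "\<exists>B :: 'h set. orthonormal_basis B"
  using assms gram_schmidt unfolding orthonormal_basis_iff by metis

text \<open>Coordinates in an orthonormal basis are at most \<open>norm x\<close>, so the norms of
  the images of the basis vectors add up to a bound. Boundedness makes the exponential series
  converge.\<close>

lemma linear_imp_bounded_linear:
  fixes A :: "'h::complex_hilbert \<Rightarrow> 'h"
  assumes "Vector_Spaces.linear scaleC scaleC A"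
    and "\<exists>B :: 'h set. finite B \<and> complex_vector.span B = UNIV"
  shows "bounded_linear A"
proof -
  interpret A: Vector_Spaces.linear scaleC scaleC A by fact
  obtain B :: "'h set" where "orthonormal_basis B"
    using orthonormal_basis_exists[OF assms(2)] by blast
  then have B: "finite B" "orthonormal_set B" "complex_vector.span B = UNIV"
    by (auto simp: orthonormal_basis_iff)
  show ?thesis
  proof (rule bounded_linear_intro)
    fix x :: 'h
    have "A x = A (\<Sum>b\<in>B. cinner b x *\<^sub>C b)"
      using orthonormal_expansion[OF B(1,2), of x] B(3) by simp
    also have "\<dots> = (\<Sum>b\<in>B. cinner b x *\<^sub>C A b)" by (simp add: A.sum A.scale)
    also have "norm \<dots> \<le> (\<Sum>b\<in>B. norm x * norm (A b))"
      by (intro sum_norm_le)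
        (simp add: norm_scaleC mult_right_mono norm_cinner_unit_le orthonormal_set_norm[OF B(2)])
    finally show "norm (A x) \<le> norm x * (\<Sum>b\<in>B. norm (A b))" by (simp add: sum_distrib_left)
  qed (simp_all add: A.add A.scale scaleR_scaleC)
qed

section \<open>Operator exponentials\<close>

lemma bounded_linear_funpow:
  assumes "bounded_linear (A :: 'a::real_normed_vector \<Rightarrow> 'a)"
  shows "bounded_linear (A ^^ n)"
proof (induction n)
  case 0
  then show ?case by (simp add: id_def bounded_linear_ident)
next
  case (Suc n)
  then show ?case using bounded_linear_compose[OF assms] by (simp add: o_def)
qed

lemma funpow_norm_bound:
  fixes A :: "'a::real_normed_vector \<Rightarrow> 'a"
  assumes "\<And>x. norm (A x) \<le> K * norm x" "K \<ge> 0"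
  shows "norm ((A ^^ n) x) \<le> K ^ n * norm x"
proof (induction n)
  case (Suc n)
  have "norm ((A ^^ Suc n) x) \<le> K * norm ((A ^^ n) x)" using assms(1) by simp
  also have "\<dots> \<le> K * (K ^ n * norm x)" using Suc assms(2) by (rule mult_left_mono)
  finally show ?case by (simp add: mult.assoc)
qed simp

lemma op_exp_norm_summable:
  fixes A :: "'h::complex_hilbert \<Rightarrow> 'h"
  assumes "bounded_linear A"
  shows "summable (\<lambda>n. norm ((A ^^ n) x /\<^sub>R fact n))"
proof -
  obtain K where K: "\<And>x. norm (A x) \<le> K * norm x" "K > 0"
    using bounded_linear.pos_bounded[OF assms] by (auto simp: mult.commute)
  show ?thesis
  proof (rule summable_comparison_test')
    show "summable (\<lambda>n. (K ^ n /\<^sub>R fact n) * norm x)"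
      by (intro summable_mult2 summable_exp_generic)
    show "norm (norm ((A ^^ n) x /\<^sub>R fact n)) \<le> (K ^ n /\<^sub>R fact n) * norm x" for n
      using funpow_norm_bound[of A K n x] K by (simp add: field_simps)
  qed
qed

lemma op_exp_sums:
  fixes A :: "'h::complex_hilbert \<Rightarrow> 'h"
  assumes "bounded_linear A"
  shows "(\<lambda>n. (A ^^ n) x /\<^sub>R fact n) sums op_exp A x"
  unfolding op_exp_def
  by (rule summable_sums[OF summable_norm_cancel[OF op_exp_norm_summable[OF assms]]])

lemma op_exp_linear:
  fixes A :: "'h::complex_hilbert \<Rightarrow> 'h"
  assumes "Vector_Spaces.linear scaleC scaleC A" and "bounded_linear A"
  shows "Vector_Spaces.linear scaleC scaleC (op_exp A)"
proof -
  interpret A: Vector_Spaces.linear scaleC scaleC A by fact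
  have add: "(A ^^ n) (x + y) = (A ^^ n) x + (A ^^ n) y" for n x y
    by (induction n) (simp_all add: A.add)
  have scale: "(A ^^ n) (a *\<^sub>C x) = a *\<^sub>C (A ^^ n) x" for n a x
    by (induction n) (simp_all add: A.scale)
  \<comment> \<open>Continuity of complex scaling lets scalars pass through the infinite
    sum.\<close>
  have bl: "bounded_linear (\<lambda>x :: 'h. a *\<^sub>C x)" for a
    by (rule bounded_linear_intro[of _ "norm a"])
      (simp_all add: scaleC_add_right scaleR_scaleC scaleC_scaleC mult.commute norm_scaleC)
  show ?thesis
  proof (unfold_locales)
    fix x y :: 'h and a :: complex
    have "(\<lambda>n. (A ^^ n) (x + y) /\<^sub>R fact n) sums (op_exp A x + op_exp A y)"
      using sums_add[OF op_exp_sums[OF assms(2), of x] op_exp_sums[OF assms(2), of y]]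
      by (simp add: add scaleR_add_right)
    then show "op_exp A (x + y) = op_exp A x + op_exp A y"
      using op_exp_sums[OF assms(2)] sums_unique2 by blast
    have "(\<lambda>n. (A ^^ n) (a *\<^sub>C x) /\<^sub>R fact n) sums (a *\<^sub>C op_exp A x)"
      using bounded_linear.sums[OF bl op_exp_sums[OF assms(2), of x], of a]
      by (simp add: scale scaleR_scaleC scaleC_scaleC mult.commute)
    then show "op_exp A (a *\<^sub>C x) = a *\<^sub>C op_exp A x"
      using op_exp_sums[OF assms(2)] sums_unique2 by blast
  qed
qed

text \<open>Cauchy product of the two exponential series: grouped by total degree \<open>k\<close>,
  the terms add up to \<open>(1 - 1)^k / k!\<close> times the \<open>k\<close>-th power of
  \<open>A\<close>, which vanishes for positive \<open>k\<close>.\<close>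

lemma op_exp_minus_cancel:
  fixes A :: "'h::complex_hilbert \<Rightarrow> 'h"
  assumes A: "bounded_linear A"
  shows "op_exp (\<lambda>x. - A x) (op_exp A x) = x"
proof -
  define N where "N = (\<lambda>x. - A x)"
  have N: "bounded_linear N" unfolding N_def by (rule bounded_linear_minus[OF A])
  have powN: "(N ^^ m) y = (-1) ^ m *\<^sub>R (A ^^ m) y" for m y
    by (induction m) (simp_all add: N_def linear_simps[OF A])
  \<comment> \<open>The product of the \<open>m\<close>-th term of the series of \<open>- A\<close>
    and the \<open>n\<close>-th term of the series of \<open>A\<close>, applied to
    \<open>x\<close>.\<close>
  define h where "h = (\<lambda>(m, n). ((-1) ^ m / (fact m * fact n)) *\<^sub>R (A ^^ (m + n)) x)"
  obtain K where K: "\<And>x. norm (A x) \<le> K * norm x" "K > 0"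
    using bounded_linear.pos_bounded[OF A] by (auto simp: mult.commute)
  \<comment> \<open>Terms of the scalar series for \<open>exp K\<close>; their products dominate
    \<open>h\<close> and justify rearranging the double sum.\<close>
  define k where "k = (\<lambda>n. K ^ n /\<^sub>R fact n)"
  have k0: "k n \<ge> 0" for n using K by (simp add: k_def)
  have ksum: "(k has_sum exp K) UNIV"
    unfolding k_def by (rule norm_summable_imp_has_sum[OF summable_norm_exp exp_converges])
  have hbound: "norm (h (m, n)) \<le> k m * k n * norm x" for m n
  proof -
    have "norm (h (m, n)) = norm ((A ^^ (m + n)) x) / (fact m * fact n)"
      by (simp add: h_def abs_mult power_abs divide_inverse)
    also have "\<dots> \<le> (K ^ (m + n) * norm x) / (fact m * fact n)"
      using funpow_norm_bound[of A K "m + n" x] K by (intro divide_right_mono) auto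
    finally show ?thesis by (simp add: k_def power_add field_simps)
  qed
  have "(\<lambda>(m, n). k m * k n * norm x) summable_on (UNIV \<times> UNIV)"
  proof (rule summable_on_SigmaI)
    show "((\<lambda>n. case (m, n) of (m, n) \<Rightarrow> k m * k n * norm x) has_sum (k m * exp K * norm x)) UNIV"
      for m unfolding prod.case
      by (intro has_sum_cmult_left has_sum_cmult_right ksum)
    show "(\<lambda>m. k m * exp K * norm x) summable_on UNIV"
      using ksum by (intro summable_on_cmult_left) (auto simp: summable_on_def)
  qed (use k0 in auto)
  then have "h abs_summable_on (UNIV \<times> UNIV)"
    by (rule Infinite_Sum.abs_summable_on_comparison_test') (use hbound in auto)
  then obtain H where H: "(h has_sum H) (UNIV \<times> UNIV)"
    using abs_summable_summable summable_on_def by blast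
  \<comment> \<open>Summing over \<open>n\<close> first: the bounded operator \<open>N ^^ m\<close>
    passes through the series of \<open>op_exp A x\<close>.\<close>
  have row: "((\<lambda>n. h (m, n)) has_sum ((N ^^ m) (op_exp A x) /\<^sub>R fact m)) UNIV" for m
  proof -
    have bl: "bounded_linear (\<lambda>y. (N ^^ m) y /\<^sub>R fact m)"
      by (rule bounded_linear_compose[OF bounded_linear_scaleR_right bounded_linear_funpow[OF N]])
    have h: "h (m, n) = (N ^^ m) ((A ^^ n) x /\<^sub>R fact n) /\<^sub>R fact m" for n
      by (simp add: h_def powN linear_simps[OF bounded_linear_funpow[OF A]] funpow_add
          divide_inverse mult_ac)
    have "((\<lambda>n. (A ^^ n) x /\<^sub>R fact n) has_sum op_exp A x) UNIV"
      by (rule norm_summable_imp_has_sum[OF op_exp_norm_summable[OF A] op_exp_sums[OF A]])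
    from has_sum_bounded_linear[OF bl this] show ?thesis by (simp add: h o_def)
  qed
  have "((\<lambda>m. (N ^^ m) (op_exp A x) /\<^sub>R fact m) has_sum H) UNIV"
    by (rule has_sum_SigmaD[OF H]) (use row in simp)
  then have 1: "op_exp N (op_exp A x) = H"
    using has_sum_imp_sums op_exp_sums[OF N] sums_unique2 by blast
  \<comment> \<open>The same double sum along the diagonals \<open>m + n = k\<close>. The
    subtraction is never truncated, since \<open>m\<close> is at most \<open>k\<close>.\<close>
  have "((\<lambda>(k, m). h (m, k - m)) has_sum H) (SIGMA k:UNIV. {..k})"
    using H by (subst has_sum_reindex_bij_witness[of _
          "\<lambda>(m, n). (m + n, m)" "\<lambda>(k, m). (m, k - m)"]) auto
  from has_sum_SigmaD[OF this]
  have 2: "((\<lambda>k. \<Sum>m\<le>k. h (m, k - m)) has_sum H) UNIV"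
    by (simp add: has_sum_finite)
  \<comment> \<open>The binomial theorem for \<open>(-1) + 1\<close>; degree 0 survives because
    \<open>0 ^ 0 = 1\<close>.\<close>
  have "(\<Sum>m\<le>k. h (m, k - m)) = (if k = 0 then x else 0)" for k
  proof -
    have "(\<Sum>m\<le>k. h (m, k - m))
        = (\<Sum>m\<le>k. (of_nat (k choose m) * (-1) ^ m * 1 ^ (k - m) / fact k :: real)) *\<^sub>R (A ^^ k) x"
      unfolding scaleR_sum_left
      by (intro sum.cong) (auto simp: h_def binomial_fact divide_inverse mult_ac)
    also have "\<dots> = (((-1) + 1) ^ k / fact k :: real) *\<^sub>R (A ^^ k) x"
      unfolding binomial_ring sum_divide_distrib ..
    finally show ?thesis by (cases k) simp_all
  qed
  with 2 have "((\<lambda>k. if k = (0::nat) then x else 0) has_sum H) UNIV" by simp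
  then have "H = x"
    using has_sum_imp_sums sums_single[of 0 "\<lambda>_. x"] sums_unique2 by blast
  with 1 show ?thesis by (simp add: N_def)
qed

lemma op_exp_scaleC_minus_cancel:
  fixes V :: "'h::complex_hilbert \<Rightarrow> 'h"
  assumes "bounded_linear (\<lambda>x. c *\<^sub>C V x)"
  shows "op_exp (\<lambda>x. (- c) *\<^sub>C V x) (op_exp (\<lambda>x. c *\<^sub>C V x) x) = x"
  using op_exp_minus_cancel[OF assms] by (simp add: complex_vector.scale_minus_left)

section \<open>Traces and ranks of self-adjoint operators\<close>

text \<open>Expanding in \<open>E\<close>, swapping the sums and contracting over the chosen basis
  moves the trace to any orthonormal set whose span contains the range. It thus gives basis
  independence and lets the rank enter.\<close>

lemma op_trace_eq_sum_range:
  fixes A :: "'h::complex_hilbert \<Rightarrow> 'h"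
  assumes fd: "\<exists>B :: 'h set. finite B \<and> complex_vector.span B = UNIV"
    and A: "self_adjoint A"
    and E: "finite E" "orthonormal_set E" "range A \<subseteq> complex_vector.span E"
  shows "op_trace A = (\<Sum>e\<in>E. cinner e (A e))"
proof -
  define B where "B = (SOME B :: 'h set. orthonormal_basis B)"
  have "orthonormal_basis B"
    unfolding B_def by (rule someI_ex[OF orthonormal_basis_exists[OF fd]])
  then have B: "finite B" "orthonormal_set B" "complex_vector.span B = UNIV"
    by (auto simp: orthonormal_basis_iff)
  have adj: "cinner x (A y) = cinner (A x) y" for x y
    using A by (simp add: self_adjoint_def)
  have "op_trace A = (\<Sum>b\<in>B. \<Sum>e\<in>E. cinner e (A b) * cinner b e)"
    unfolding op_trace_def B_def[symmetric]
    by (intro sum.cong refl cinner_parseval[OF E(1,2)]) (use E(3) in auto)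
  \<comment> \<open>Self-adjointness moves \<open>A\<close> onto \<open>e\<close>, so that the inner
    sum is a Parseval sum over \<open>B\<close>.\<close>
  also have "\<dots> = (\<Sum>e\<in>E. \<Sum>b\<in>B. cinner b e * cinner (A e) b)"
    by (subst sum.swap) (simp add: adj mult.commute)
  also have "\<dots> = (\<Sum>e\<in>E. cinner (A e) e)"
    by (intro sum.cong refl cinner_parseval[OF B(1,2), symmetric]) (simp add: B(3))
  finally show ?thesis by (simp add: adj)
qed

lemma purity_ge_inverse_rank:
  fixes \<rho> :: "'h::complex_hilbert \<Rightarrow> 'h"
  assumes fd: "\<exists>B :: 'h set. finite B \<and> complex_vector.span B = UNIV"
    and \<rho>: "self_adjoint \<rho>" "op_trace \<rho> = 1"
    and E: "finite E" "orthonormal_set E" "range \<rho> \<subseteq> complex_vector.span E"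
  shows "card E > 0 \<and> purity \<rho> \<ge> 1 / real (card E)"
proof -
  have adj: "cinner x (\<rho> y) = cinner (\<rho> x) y" for x y
    using \<rho>(1) by (simp add: self_adjoint_def)
  have "self_adjoint (\<rho> \<circ> \<rho>)"
    using \<rho>(1) by (auto simp: self_adjoint_def intro: Vector_Spaces.linear_compose)
  moreover have "range (\<rho> \<circ> \<rho>) \<subseteq> complex_vector.span E" using E(3) by auto
  ultimately have "op_trace (\<rho> \<circ> \<rho>) = (\<Sum>e\<in>E. cinner e ((\<rho> \<circ> \<rho>) e))"
    using E(1,2) by (intro op_trace_eq_sum_range[OF fd])
  then have pur: "purity \<rho> = (\<Sum>e\<in>E. (norm (\<rho> e))\<^sup>2)"
    by (simp add: purity_def adj cinner_norm flip: of_real_power)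
  have tr: "(\<Sum>e\<in>E. cinner e (\<rho> e)) = 1"
    using op_trace_eq_sum_range[OF fd \<rho>(1) E] \<rho>(2) by simp
  \<comment> \<open>For empty \<open>E\<close> the trace would be 0 instead of 1.\<close>
  then have pos: "card E > 0" using E(1) by (auto simp: card_gt_0_iff)
  have "1 = norm (\<Sum>e\<in>E. cinner e (\<rho> e))" by (simp add: tr)
  also have "\<dots> \<le> (\<Sum>e\<in>E. norm (\<rho> e))"
    by (intro sum_norm_le norm_cinner_unit_le orthonormal_set_norm[OF E(2)])
  finally have "1 \<le> (\<Sum>e\<in>E. norm (\<rho> e))\<^sup>2" by (simp add: power2_eq_square mult_ge1_I)
  also have "\<dots> \<le> (\<Sum>e\<in>E. (norm (\<rho> e))\<^sup>2) * real (card E)"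
    using Cauchy_Schwarz_ineq_sum[of "\<lambda>e. norm (\<rho> e)" "\<lambda>_. 1" E] by simp
  finally show ?thesis using pos by (simp add: pur divide_le_eq)
qed

text \<open>\<open>W\<close> carries the range of \<open>\<rho>\<close> into its kernel, which is
  orthogonal to the range by self-adjointness. As \<open>W\<close> is injective, two orthogonal
  subspaces of dimension \<open>card E\<close> fit into the whole space.\<close>

lemma card_range_basis_le_half_dim:
  fixes \<rho> W :: "'h::complex_hilbert \<Rightarrow> 'h"
  assumes fd: "\<exists>B :: 'h set. finite B \<and> complex_vector.span B = UNIV"
    and \<rho>: "self_adjoint \<rho>"
    and W: "Vector_Spaces.linear scaleC scaleC W" "inj W"
    and annih: "\<And>x. \<rho> (W (\<rho> x)) = 0"
    and E: "finite E" "orthonormal_set E" "complex_vector.span E = range \<rho>"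
  shows "2 * card E \<le> complex_vector.dim (UNIV :: 'h set)"
proof -
  interpret W: Vector_Spaces.linear scaleC scaleC W by fact
  have adj: "cinner x (\<rho> y) = cinner (\<rho> x) y" for x y
    using \<rho> by (simp add: self_adjoint_def)
  have WE: "complex_vector.independent (W ` E)"
    by (rule W.independent_inj_image[OF orthonormal_set_independent[OF E(2)] W(2)])
  \<comment> \<open>\<open>W\<close> need not preserve orthogonality, so the image of
    \<open>E\<close> is orthonormalised again; injectivity keeps its cardinality.\<close>
  obtain F where F: "finite F" "orthonormal_set F"
      "complex_vector.span F = complex_vector.span (W ` E)"
    using gram_schmidt[of "W ` E"] E(1) by blast
  have "card E = card (W ` E)"
    using W(2) by (metis card_image inj_on_subset subset_UNIV)
  also have "\<dots> = card F"
    by (metis F(2,3) WE complex_vector.dim_span_eq_card_independent orthonormal_set_independent)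
  finally have card: "card F = card E" by simp
  have \<rho>F: "\<rho> f = 0" if "f \<in> F" for f
  proof -
    have "f \<in> W ` range \<rho>"
      using that F(3) complex_vector.span_base[of f F] W.span_image[of E] E(3) by auto
    then show ?thesis using annih by auto
  qed
  have fe: "cinner f e = 0" if fe: "e \<in> E" "f \<in> F" for e f
  proof -
    \<comment> \<open>Writing \<open>e = \<rho> y\<close> moves \<open>\<rho>\<close> onto
      \<open>f\<close>, where it vanishes.\<close>
    obtain y where "e = \<rho> y" using E(3) complex_vector.span_base[OF fe(1)] by auto
    then show ?thesis using \<rho>F[OF fe(2)] by (simp add: adj)
  qed
  then have ef: "cinner e f = 0" if "e \<in> E" "f \<in> F" for e f
    using that by (metis cinner_commute complex_cnj_zero)
  \<comment> \<open>A common vector would be orthogonal to itself despite having norm 1.\<close>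
  have disj: "E \<inter> F = {}"
    using fe E(2) by (fastforce simp: orthonormal_set_def)
  have "orthonormal_set (E \<union> F)"
    using E(2) F(2) fe ef disj by (auto simp: orthonormal_set_def)
  then have ind: "complex_vector.independent (E \<union> F)" by (rule orthonormal_set_independent)
  obtain B :: "'h set" where B: "finite B" "orthonormal_set B" "complex_vector.span B = UNIV"
    using orthonormal_basis_exists[OF fd] by (auto simp: orthonormal_basis_iff)
  have "card (E \<union> F) \<le> card B"
    using complex_vector.independent_span_bound[OF B(1) ind] B(3) by simp
  also have "card B = complex_vector.dim (UNIV :: 'h set)"
    by (metis B(2,3) complex_vector.dim_span_eq_card_independent orthonormal_set_independent)
  finally show ?thesis using card card_Un_disjoint[OF E(1) F(1) disj] by simp
qed

section \<open>The purity bound\<close>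

theorem mainTheorem3:
  fixes V0 V1 \<rho> :: "'h::complex_hilbert \<Rightarrow> 'h"
    and d :: nat and t :: real
  assumes "\<exists>B :: 'h set. finite B \<and> complex_vector.span B = UNIV"
    and "d = complex_vector.dim (UNIV :: 'h set)"
    and "d \<ge> 2"
    and "self_adjoint V0" and "self_adjoint V1"
    and "density_operator \<rho>"
    and "conditional_state V0 \<rho> t \<circ> conditional_state V1 \<rho> t = (\<lambda>x. 0)"
  shows "(even d \<longrightarrow> purity \<rho> \<ge> 2 / real d) \<and> (odd d \<longrightarrow> purity \<rho> \<ge> 2 / (real d - 1))"
proof -
  note fd = assms(1)
  define U where "U = (\<lambda>(V :: 'h \<Rightarrow> 'h) c. op_exp (\<lambda>x. c *\<^sub>C V x))"
  have lin: "Vector_Spaces.linear scaleC scaleC (\<lambda>x. c *\<^sub>C V x)" if "self_adjoint V"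
    for V :: "'h \<Rightarrow> 'h" and c
  proof -
    interpret V: Vector_Spaces.linear scaleC scaleC V using that by (simp add: self_adjoint_def)
    show ?thesis
      by unfold_locales (simp_all add: V.add V.scale scaleC_add_right scaleC_scaleC mult.commute)
  qed
  have linU: "Vector_Spaces.linear scaleC scaleC (U V c)" if "self_adjoint V" for V c
    unfolding U_def by (intro op_exp_linear lin linear_imp_bounded_linear[OF _ fd] that)
  have inv: "U V (- c) (U V c x) = x" if "self_adjoint V" for V c x
    unfolding U_def
    by (intro op_exp_scaleC_minus_cancel linear_imp_bounded_linear[OF _ fd] lin that)
  define s where "s = \<i> * complex_of_real t"
  have cs: "conditional_state V \<rho> t x = U V (- s) (\<rho> (U V s x))" for V x
    by (simp add: conditional_state_def U_def s_def)
  \<comment> \<open>The two inner exponentials that stand between the copies of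
    \<open>\<rho>\<close> in the product of the conditional states.\<close>
  define W where "W = U V0 s \<circ> U V1 (- s)"
  have W: "Vector_Spaces.linear scaleC scaleC W"
    unfolding W_def by (rule Vector_Spaces.linear_compose[OF linU[OF assms(5)] linU[OF assms(4)]])
  have "inj W"
  proof (rule injI)
    fix x y assume "W x = W y"
    then have "U V0 (- s) (W x) = U V0 (- s) (W y)" by simp
    then have "U V1 (- s) x = U V1 (- s) y" by (simp add: W_def inv[OF assms(4)])
    \<comment> \<open>The double negation is kept so that \<open>inv\<close> applies with
      \<open>- s\<close> as its coefficient.\<close>
    then have "U V1 (- (- s)) (U V1 (- s) x) = U V1 (- (- s)) (U V1 (- s) y)" by simp
    then show "x = y" by (simp only: inv[OF assms(5)])
  qed
  have annih: "\<rho> (W (\<rho> x)) = 0" for x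
  proof -
    have x: "U V1 s (U V1 (- s) x) = x" using inv[OF assms(5), of "- s"] by simp
    \<comment> \<open>Evaluating the orthogonality condition at \<open>U V1 (- s) x\<close> cancels
      its rightmost exponential; the leftmost one is then removed by its inverse.\<close>
    have "U V0 (- s) (\<rho> (W (\<rho> x))) = 0"
      using fun_cong[OF assms(7), of "U V1 (- s) x"] by (simp add: cs W_def x)
    then have "\<rho> (W (\<rho> x)) = U V0 s 0"
      using inv[OF assms(4), of "- s" "\<rho> (W (\<rho> x))"] by simp
    also have "U V0 s 0 = 0"
    proof -
      interpret U: Vector_Spaces.linear scaleC scaleC "U V0 s" by (rule linU[OF assms(4)])
      show ?thesis by (rule U.zero)
    qed
    finally show ?thesis .
  qed
  have \<rho>: "self_adjoint \<rho>" "op_trace \<rho> = 1"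
    using assms(6) by (auto simp: density_operator_def)
  interpret \<rho>: Vector_Spaces.linear scaleC scaleC \<rho>
    using \<rho>(1) by (simp add: self_adjoint_def)
  obtain B :: "'h set" where B: "finite B" "complex_vector.span B = UNIV" using fd by blast
  have "complex_vector.span (\<rho> ` B) = range \<rho>" by (simp add: \<rho>.span_image B(2))
  then obtain E where E: "finite E" "orthonormal_set E" "complex_vector.span E = range \<rho>"
    using gram_schmidt[of "\<rho> ` B"] B(1) by auto
  have le: "2 * card E \<le> d"
    unfolding assms(2) by (rule card_range_basis_le_half_dim[OF fd \<rho>(1) W \<open>inj W\<close> annih E])
  have pos: "card E > 0" and pur: "purity \<rho> \<ge> 1 / real (card E)"
    using purity_ge_inverse_rank[OF fd \<rho> E(1,2)] E(3) by auto
  \<comment> \<open>Covers both parities: \<open>r\<close> becomes \<open>d\<close> or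
    \<open>d - 1\<close>.\<close>
  have bound: "purity \<rho> \<ge> 2 / r" if "2 * real (card E) \<le> r" for r
  proof -
    have "2 / r \<le> 2 / (2 * real (card E))"
      using that pos by (intro divide_left_mono) auto
    with pur show ?thesis by simp
  qed
  show ?thesis
  proof (intro conjI impI)
    show "2 / real d \<le> purity \<rho>" using le by (intro bound) linarith
  next
    assume "odd d"
    \<comment> \<open>An even number cannot equal the odd \<open>d\<close>, so the rank bound
      improves by one.\<close>
    with le have "2 * card E + 1 \<le> d" by presburger
    then show "2 / (real d - 1) \<le> purity \<rho>" by (intro bound) linarith
  qed
qed

end
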